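(* There exists an absolute constant $c>0$ such that the following holds. Let $n\ge 1$ be an integer and let $F\in\mathfrak F$ be a distribution represented in the form $$F=(1-p)\,U+p\,V,\qquad U,V\in\mathfrak F,\quad 0<p<1.$$ Let $X$ be a random variable with $\mathcal L(X)=U$. Suppose that $$0<\sigma^2=\mathbf E X^2<\infty,\qquad \mathbf E X=0\qquad(\sigma>0),$$ and $$b\ge\frac{\varkappa_n}{\sigma^2},\qquad\text{where}\quad \varkappa_n=\mathbf E\, X^2\min\{|X|,\,\sigma\sqrt n\}.$$ Then, for any $\delta>0$, $$Q(F^n,b)\le\frac{c\,b\,(\delta+\sigma)}{\delta\,\sigma\,n\,\sqrt{(1-p)\,D\big(\widetilde F,\,\delta\sqrt n\big)}}.$$
   Context: $\mathfrak F$ denotes the set of probability distributions on the Borel $\sigma$-field of $\mathbf R$; $\mathcal L(\xi)\in\mathfrak F$ is the distribution of a random variable $\xi$. For $F\in\mathfrak F$ and $b\ge0$ the concentration function is $Q(F,b)=\sup_{x\in\mathbf R}F\{[x,x+b]\}$. Products and powers of measures are in the convolution sense: $FH=F*H$, $H^m=H^{m*}$ ($m$-fold convolution). For $F=\mathcal L(\xi)\in\mathfrak F$ put $\overline F=\mathcal L(-\xi)$ and let $\widetilde F=F\,\overline F$ (convolution) be the symmetrized distribution. For $F\in\mathfrak F$ and $b>0$, $$D(F,b)=\int_{-\infty}^{\infty}\min\{x^2b^{-2},\,1\}\,F\{dx\}.$$ An absolute constant is a positive number depending on none of the objects in the statement ($n,p,F,U,V,b,\delta$). *)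

theory Defs
  imports "HOL-Probability.Probability"
begin

text \<open>
  Probability distributions on the Borel sets of the reals are the measures satisfying
  \<^locale>\<open>real_distribution\<close>; products of distributions are convolutions.
\<close>

primrec convolution_power :: "real measure \<Rightarrow> nat \<Rightarrow> real measure" where
  "convolution_power F 0 = return borel 0"
| "convolution_power F (Suc n) = convolution F (convolution_power F n)"

definition symmetrized :: "real measure \<Rightarrow> real measure" where
  "symmetrized F = convolution F (distr F borel uminus)"

definition concentration :: "real measure \<Rightarrow> real \<Rightarrow> real" where
  "concentration F b = (SUP x. measure F {x..x + b})"

definition truncated_moment :: "real measure \<Rightarrow> real \<Rightarrow> real" where
  "truncated_moment F b = (\<integral>x. min (x\<^sup>2 / b\<^sup>2) 1 \<partial>F)"

definition is_mixture :: "real \<Rightarrow> real measure \<Rightarrow> real measure \<Rightarrow> real measure \<Rightarrow> bool" where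
  "is_mixture p U V F \<longleftrightarrow>
     (\<forall>A\<in>sets borel. measure F A = (1 - p) * measure U A + p * measure V A)"

text \<open>
  Expectations of functions of a random variable with distribution \<open>U\<close> are written as integrals
  with respect to \<open>U\<close>, which is justified by the following change of variables. This avoids
  quantifying over a sample space, whose type could not be bound inside the scope of an absolute
  constant.
\<close>

lemma expectation_law:
  fixes g :: "real \<Rightarrow> real"
  assumes "X \<in> borel_measurable M" and "distr M borel X = U" and "g \<in> borel_measurable borel"
  shows "(\<integral>\<omega>. g (X \<omega>) \<partial>M) = (\<integral>x. g x \<partial>U)"
    and "integrable M (\<lambda>\<omega>. g (X \<omega>)) \<longleftrightarrow> integrable U g"
proof -
  show "(\<integral>\<omega>. g (X \<omega>) \<partial>M) = (\<integral>x. g x \<partial>U)"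
    using integral_distr[OF assms(1,3)] assms(2) by simp
  show "integrable M (\<lambda>\<omega>. g (X \<omega>)) \<longleftrightarrow> integrable U g"
    using integrable_distr_eq[OF assms(1,3)] assms(2) by simp
qed

text \<open>For \<open>U\<close> with variance \<open>\<sigma>\<^sup>2\<close>, the quantity \<open>E X\<^sup>2 min {|X|, \<sigma> sqrt n}\<close>, where \<open>X\<close> has distribution \<open>U\<close>.\<close>

definition kappa :: "real measure \<Rightarrow> real \<Rightarrow> nat \<Rightarrow> real" where
  "kappa U \<sigma> n = (\<integral>x. x\<^sup>2 * min \<bar>x\<bar> (\<sigma> * sqrt (real n)) \<partial>U)"

end

theory Submission
  imports Defs
begin

text \<open>
  The proof is Fourier analytic. By Esseen's inequality (\<open>Esseen_concentration_inequality\<close>), the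
  concentration function of the \<open>n\<close>-fold convolution at \<open>b\<close> is at most a constant times \<open>b\<close> times the
  integral of \<open>f(t)\<^sup>n\<close>, \<open>f(t) = |char F t|\<close>, over \<open>0 \<le> t \<le> 1 / (4 b)\<close>. On this range there are two sources
  of decay.

  The first is \<open>U\<close>: the hypothesis on \<open>b\<close> says that the cubic error in the Taylor expansion of its
  characteristic function is dominated by the quadratic term, so that \<open>f(t)\<^sup>n\<close> is at most a constant
  times \<open>exp (- n (1 - p) \<sigma>\<^sup>2 t\<^sup>2 / 4)\<close>. The second is \<open>F\<close> itself:
  \<open>f(t)\<^sup>n \<le> exp (- (n / 2) (1 - f(t)\<^sup>2))\<close>, where \<open>1 - f(t)\<^sup>2\<close> is the integral of \<open>1 - cos (t x)\<close> against the
  symmetrized distribution. The lemma \<open>power_char_le\<close> combines the two by spending half of each exponent.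
  The Gaussian factor confines \<open>t\<close> to the scale \<open>1 / a\<close> with \<open>a = \<sigma> sqrt (n (1 - p)) / 2\<close>, and may be
  replaced by \<open>exp (- a t)\<close>.

  It remains to integrate the second factor against \<open>exp (- a t)\<close>. Jensen's inequality, for the
  symmetrized distribution weighted by \<open>min (x\<^sup>2 / r\<^sup>2) 1\<close> with \<open>r = \<delta> sqrt n\<close>, reduces this to a
  distribution concentrated in one point \<open>x\<close>. The integrand is then periodic in \<open>t\<close>, with narrow peaks at
  the multiples of \<open>2 \<pi> / |x|\<close>. The width of the peaks gives the factor \<open>1 / sqrt (n D)\<close>, with \<open>D\<close> the
  truncated moment at \<open>r\<close>, and counting the peaks within the scale \<open>1 / a\<close> gives \<open>1 / r + 1 / a\<close>
  (\<open>nn_integral_exp_symmetric_le\<close>). The product is the asserted bound, because \<open>1 / r + 1 / a\<close> is at most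
  \<open>2 (\<delta> + \<sigma>) / (\<delta> \<sigma> sqrt (n (1 - p)))\<close>.
\<close>

section \<open>Characteristic functions\<close>

lemma real_distribution_convolution:
  assumes "real_distribution M" and "real_distribution N"
  shows "real_distribution (convolution M N)"
proof -
  interpret M: real_distribution M by fact
  interpret N: real_distribution N by fact
  interpret P: pair_prob_space M N ..
  show ?thesis
    unfolding convolution_def by (rule P.real_distribution_distr) measurable
qed

lemma char_convolution:
  assumes "real_distribution M" and "real_distribution N"
  shows "char (convolution M N) t = char M t * char N t"
proof -
  interpret M: real_distribution M by fact
  interpret N: real_distribution N by fact
  interpret P: pair_prob_space M N ..
  have int: "integrable (M \<Otimes>\<^sub>M N) (\<lambda>(x, y). iexp (t * (x + y)))"
    by (rule P.integrable_const_bound[where B = 1]) auto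
  have "char (convolution M N) t = (\<integral>(x, y). iexp (t * (x + y)) \<partial>(M \<Otimes>\<^sub>M N))"
    unfolding char_def convolution_def by (subst integral_distr) (auto simp: case_prod_unfold)
  also have "\<dots> = (\<integral>x. (\<integral>y. iexp (t * (x + y)) \<partial>N) \<partial>M)"
    using P.integral_fst[OF int] by simp
  also have "\<dots> = (\<integral>x. (\<integral>y. iexp (t * x) * iexp (t * y) \<partial>N) \<partial>M)"
    by (simp add: exp_add[symmetric] algebra_simps)
  also have "\<dots> = char M t * char N t"
    unfolding char_def by simp
  finally show ?thesis .
qed

lemma real_distribution_convolution_power:
  assumes "real_distribution F"
  shows "real_distribution (convolution_power F n)"
proof (induction n)
  case 0
  have "prob_space (return borel (0::real))"
    by (rule prob_space_return) simp
  then show ?case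
    by (simp add: real_distribution_def real_distribution_axioms_def)
next
  case (Suc n)
  with assms show ?case
    by (simp add: real_distribution_convolution)
qed

lemma char_convolution_power:
  assumes "real_distribution F"
  shows "char (convolution_power F n) t = char F t ^ n"
proof (induction n)
  case 0
  show ?case
    by (simp add: char_def integral_return)
next
  case (Suc n)
  with assms show ?case
    by (simp add: char_convolution real_distribution_convolution_power)
qed

lemma char_distr_uminus:
  assumes "real_distribution F"
  shows "char (distr F borel uminus) t = cnj (char F t)"
proof -
  interpret real_distribution F by fact
  have "char (distr F borel uminus) t = (\<integral>x. iexp (t * (- x)) \<partial>F)"
    unfolding char_def by (subst integral_distr) auto
  also have "\<dots> = (\<integral>x. cnj (iexp (t * x)) \<partial>F)"
    by (simp add: exp_cnj)
  also have "\<dots> = cnj (char F t)"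
    unfolding char_def by (rule Bochner_Integration.integral_cnj)
  finally show ?thesis .
qed

lemma real_distribution_uminus:
  assumes "real_distribution F"
  shows "real_distribution (distr F borel uminus)"
proof -
  interpret real_distribution F by fact
  show ?thesis by (rule real_distribution_distr) measurable
qed

lemma real_distribution_symmetrized:
  assumes "real_distribution F"
  shows "real_distribution (symmetrized F)"
  unfolding symmetrized_def
  by (intro real_distribution_convolution real_distribution_uminus assms)

lemma integrable_cos:
  assumes "real_distribution S"
  shows "integrable S (\<lambda>x. cos (t * x))"
proof -
  interpret real_distribution S by fact
  show ?thesis
    by (rule integrable_const_bound[where B = 1]) auto
qed

lemma integral_cos_shift:
  assumes "real_distribution F"
  shows "(\<integral>x. cos (t * x - s) \<partial>F) = Re (cis (- s) * char F t)"
proof -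
  interpret real_distribution F by fact
  have int: "integrable F (\<lambda>x. iexp (t * x))"
    by (rule integrable_const_bound[where B = 1]) auto
  have "cis (- s) * char F t = (\<integral>x. cis (- s) * iexp (t * x) \<partial>F)"
    unfolding char_def by simp
  also have "Re \<dots> = (\<integral>x. Re (cis (- s) * iexp (t * x)) \<partial>F)"
    by (subst integral_Re) (use int in auto)
  also have "\<dots> = (\<integral>x. cos (t * x - s) \<partial>F)"
    by (simp add: cos_diff Re_exp Im_exp algebra_simps)
  finally show ?thesis by simp
qed

lemma Re_char:
  assumes "real_distribution F"
  shows "Re (char F t) = (\<integral>x. cos (t * x) \<partial>F)"
  using integral_cos_shift[OF assms, of t 0] by simp

text \<open>
This is how the symmetrized distribution enters: it turns the bound
\<open>f\<^sup>2 \<le> exp (- (1 - f\<^sup>2))\<close> for \<open>f = |char F t|\<close> into the exponential of an integral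
against \<^term>\<open>symmetrized F\<close>, on which Jensen's inequality can act.
\<close>

lemma integral_one_minus_cos_symmetrized:
  assumes "real_distribution F"
  shows "(\<integral>x. 1 - cos (t * x) \<partial>(symmetrized F)) = 1 - (cmod (char F t))\<^sup>2"
proof -
  have S: "real_distribution (symmetrized F)"
    by (rule real_distribution_symmetrized[OF assms])
  then interpret S: real_distribution "symmetrized F" .
  have "char (symmetrized F) t = char F t * cnj (char F t)"
    unfolding symmetrized_def
    by (simp add: char_convolution assms real_distribution_uminus char_distr_uminus)
  then have "char (symmetrized F) t = of_real ((cmod (char F t))\<^sup>2)"
    by (simp only: complex_norm_square)
  then have "(\<integral>x. cos (t * x) \<partial>(symmetrized F)) = (cmod (char F t))\<^sup>2"
    using Re_char[OF S, of t] by simp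
  then show ?thesis
    using S.prob_space by (simp add: Bochner_Integration.integral_diff integrable_cos[OF S])
qed

lemma nn_integral_mixture:
  assumes "real_distribution F" "real_distribution U" "real_distribution V"
    and p: "0 < p" "p < 1" and mix: "is_mixture p U V F"
    and f: "f \<in> borel_measurable borel"
  shows "(\<integral>\<^sup>+x. f x \<partial>F) = ennreal (1 - p) * (\<integral>\<^sup>+x. f x \<partial>U) + ennreal p * (\<integral>\<^sup>+x. f x \<partial>V)"
proof -
  interpret F: real_distribution F by fact
  interpret U: real_distribution U by fact
  interpret V: real_distribution V by fact
  have m: "borel_measurable F = borel_measurable borel" "borel_measurable U = borel_measurable borel"
    "borel_measurable V = borel_measurable borel"
    by (auto intro!: measurable_cong_sets)
  from f show ?thesis
  proof (induction rule: borel_measurable_induct)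
    case (cong f g)
    then have "f = g" by auto
    with cong show ?case by simp
  next
    case (set A)
    then have "ennreal (measure F A) = ennreal ((1 - p) * measure U A + p * measure V A)"
      using mix by (simp add: is_mixture_def)
    with set p show ?case
      by (simp add: F.emeasure_eq_measure U.emeasure_eq_measure V.emeasure_eq_measure
          ennreal_plus ennreal_mult)
  next
    case (mult u c)
    then show ?case
      by (simp add: nn_integral_cmult m distrib_left mult.left_commute)
  next
    case (add u v)
    then show ?case
      by (simp add: nn_integral_add m distrib_left add_ac)
  next
    case (seq W)
    have "(\<integral>\<^sup>+x. (SUP i. W i) x \<partial>M) = (SUP i. \<integral>\<^sup>+x. W i x \<partial>M)"
      if "borel_measurable M = (borel_measurable borel :: (real \<Rightarrow> ennreal) set)" for M
      using nn_integral_monotone_convergence_SUP[of W M] seq that by (simp add: image_comp)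
    note MC = this[OF m(1)] this[OF m(2)] this[OF m(3)]
    have mono: "incseq (\<lambda>i. c * (\<integral>\<^sup>+x. W i x \<partial>M))" for c and M :: "real measure"
      using \<open>incseq W\<close> by (auto simp: incseq_def le_fun_def intro!: mult_left_mono nn_integral_mono)
    show ?case
      unfolding MC seq.IH
      by (subst ennreal_SUP_add[OF mono mono]) (simp add: SUP_mult_left_ennreal)
  qed
qed

text \<open>
Adding \<open>1\<close> makes the cosine nonnegative, which reduces this to the nonnegative integral.
\<close>

lemma integral_mixture_cos:
  assumes "real_distribution F" "real_distribution U" "real_distribution V"
    and p: "0 < p" "p < 1" and mix: "is_mixture p U V F"
  shows "(\<integral>x. cos (t * x - s) \<partial>F)
    = (1 - p) * (\<integral>x. cos (t * x - s) \<partial>U) + p * (\<integral>x. cos (t * x - s) \<partial>V)"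
proof -
  have eq: "(\<integral>\<^sup>+x. ennreal (1 + cos (t * x - s)) \<partial>M) = ennreal (1 + (\<integral>x. cos (t * x - s) \<partial>M))"
    "0 \<le> 1 + (\<integral>x. cos (t * x - s) \<partial>M)"
    if "real_distribution M" for M
  proof -
    interpret real_distribution M by fact
    have int: "integrable M (\<lambda>x. cos (t * x - s))"
      by (rule integrable_const_bound[where B = 1]) auto
    have nonneg: "0 \<le> 1 + cos (t * x - s)" for x
      using cos_ge_minus_one[of "t * x - s"] by linarith
    have *: "(\<integral>x. 1 + cos (t * x - s) \<partial>M) = 1 + (\<integral>x. cos (t * x - s) \<partial>M)"
      using int prob_space by simp
    show "(\<integral>\<^sup>+x. ennreal (1 + cos (t * x - s)) \<partial>M) = ennreal (1 + (\<integral>x. cos (t * x - s) \<partial>M))"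
      using int nonneg by (subst nn_integral_eq_integral) (auto simp: *[symmetric])
    show "0 \<le> 1 + (\<integral>x. cos (t * x - s) \<partial>M)"
      unfolding *[symmetric] by (rule Bochner_Integration.integral_nonneg) (rule nonneg)
  qed
  note e = eq[OF assms(1)] eq[OF assms(2)] eq[OF assms(3)]
  define fF fU fV where "fF = (\<integral>x. cos (t * x - s) \<partial>F)" and "fU = (\<integral>x. cos (t * x - s) \<partial>U)"
    and "fV = (\<integral>x. cos (t * x - s) \<partial>V)"
  have "ennreal (1 + fF) = ennreal (1 - p) * ennreal (1 + fU) + ennreal p * ennreal (1 + fV)"
    using nn_integral_mixture[OF assms, of "\<lambda>x. ennreal (1 + cos (t * x - s))"]
    by (simp add: e fF_def fU_def fV_def)
  also have "\<dots> = ennreal ((1 - p) * (1 + fU) + p * (1 + fV))"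
    using e p by (simp add: ennreal_plus ennreal_mult fU_def fV_def)
  finally have "1 + fF = (1 - p) * (1 + fU) + p * (1 + fV)"
    using e p by (subst (asm) ennreal_inj) (auto simp: fF_def fU_def fV_def)
  then show ?thesis
    by (simp add: fF_def fU_def fV_def algebra_simps)
qed

text \<open>
A factor of modulus one makes \<^term>\<open>char F t\<close> real and nonnegative. Its modulus is then the
\<open>F\<close>-integral of a real cosine, so real-valued integrals suffice to split it along the mixture.
\<close>

lemma norm_char_mixture_le:
  assumes "real_distribution F" "real_distribution U" "real_distribution V"
    and p: "0 < p" "p < 1" and mix: "is_mixture p U V F"
  shows "cmod (char F t) \<le> (1 - p) * cmod (char U t) + p"
proof -
  interpret V: real_distribution V by fact
  define s where "s = Arg (char F t)"
  have "cis (- s) * char F t = of_real (cmod (char F t))"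
    using rcis_cmod_Arg[of "char F t"]
    by (metis s_def cis_mult cis_zero mult.commute mult.left_commute mult.right_neutral
        rcis_def add.right_inverse add.commute)
  then have "cmod (char F t) = Re (cis (- s) * char F t)"
    by simp
  also have "\<dots> = (1 - p) * Re (cis (- s) * char U t) + p * Re (cis (- s) * char V t)"
    using integral_mixture_cos[OF assms, of t s] by (simp only: integral_cos_shift assms)
  also have "\<dots> \<le> (1 - p) * cmod (char U t) + p * 1"
  proof (intro add_mono mult_left_mono)
    show "Re (cis (- s) * char U t) \<le> cmod (char U t)"
      using complex_Re_le_cmod[of "cis (- s) * char U t"] by (simp add: norm_mult)
    show "Re (cis (- s) * char V t) \<le> 1"
      using complex_Re_le_cmod[of "cis (- s) * char V t"] V.cmod_char_le_1[of t]
      by (simp add: norm_mult)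
  qed (use p in auto)
  finally show ?thesis by simp
qed

section \<open>Laplace transforms of periodic functions\<close>

text \<open>
The sine is concave on \<open>[0, \<pi>]\<close> and so lies above its chord over \<open>[0, \<pi> / 2]\<close>; apply this to
\<open>1 - cos v = 2 sin\<^sup>2 (v / 2)\<close>.
\<close>

lemma one_minus_cos_ge:
  fixes v :: real
  assumes "\<bar>v\<bar> \<le> pi"
  shows "v\<^sup>2 / 5 \<le> 1 - cos v"
proof -
  have "concave_on {0..pi} sin"
    by (rule f''_le0_imp_concave[where f' = cos and f'' = "\<lambda>x. - sin x"])
       (auto intro!: derivative_eq_intros sin_ge_zero)
  from concave_onD[OF this, of "\<bar>v\<bar> / pi" 0 "pi / 2"] assms
  have "\<bar>v\<bar> / pi \<le> sin (\<bar>v\<bar> / 2)"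
    by simp
  then have "(\<bar>v\<bar> / pi)\<^sup>2 \<le> (sin (\<bar>v\<bar> / 2))\<^sup>2"
    by (intro power_mono) auto
  also have "(sin (\<bar>v\<bar> / 2))\<^sup>2 = (1 - cos v) / 2"
    using cos_double_sin[of "\<bar>v\<bar> / 2"] by simp
  finally have "2 * v\<^sup>2 / pi\<^sup>2 \<le> 1 - cos v"
    by (simp add: power_divide mult.commute)
  moreover have "pi\<^sup>2 \<le> 10"
    using power_mono[OF pi_approx(2), of 2] by (simp add: power2_eq_square)
  then have "v\<^sup>2 / 5 \<le> 2 * v\<^sup>2 / pi\<^sup>2"
    using mult_left_mono[of "pi\<^sup>2" 10 "v\<^sup>2"] by (simp add: field_simps)
  ultimately show ?thesis by linarith
qed

lemma nn_integral_gaussian: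
  fixes c s :: real
  assumes "0 < c"
  shows "(\<integral>\<^sup>+t. ennreal (exp (- c * (t - s)\<^sup>2)) \<partial>lborel) = ennreal (sqrt (pi / c))"
proof -
  define d where "d = 1 / sqrt (2 * c)"
  have d: "0 < d" "d\<^sup>2 = 1 / (2 * c)"
    using assms by (simp_all add: d_def power_divide)
  have eq: "exp (- c * (t - s)\<^sup>2) = sqrt (pi / c) * normal_density s d t" for t
    using assms by (simp add: normal_density_def d real_sqrt_divide)
  have "(\<integral>\<^sup>+t. ennreal (normal_density s d t) \<partial>lborel) = 1"
    using d by (subst nn_integral_eq_integral) auto
  then show ?thesis
    using assms unfolding eq by (subst ennreal_mult) (auto simp: nn_integral_cmult)
qed

text \<open>
Cutting the half-line after the first period gives \<open>I \<le> G + exp (- a P) I\<close> for the left integral \<open>I\<close>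
and the one-period integral \<open>G\<close>, and \<open>1 / (1 - exp (- s)) \<le> 1 + 1 / s\<close>. So the number of periods that
count is about \<open>1 + 1 / (a P)\<close>, the number seen by an exponential of length scale \<open>1 / a\<close>.
\<close>

lemma nn_integral_exp_periodic_le:
  fixes h :: "real \<Rightarrow> real"
  assumes [measurable]: "h \<in> borel_measurable borel"
    and h: "\<And>t. 0 \<le> h t" "\<And>t. h t \<le> 1" "\<And>t. h (t + P) = h t"
    and aP: "0 < a" "0 < P"
  shows "(\<integral>\<^sup>+t. ennreal (exp (- a * t) * h t) * indicator {0..} t \<partial>lborel)
    \<le> ennreal (1 + 1 / (a * P)) * (\<integral>\<^sup>+t. ennreal (h t) * indicator {0..P} t \<partial>lborel)"
    (is "?I \<le> _ * ?G")
proof -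
  have "?I \<le> (\<integral>\<^sup>+t. ennreal (exp (- a * t)) * indicator {0..} t \<partial>lborel)"
    using h by (intro nn_integral_mono mult_right_mono ennreal_leI) (auto intro: mult_left_le)
  also have "\<dots> = ennreal (0 - (- exp (- a * 0) / a))"
  proof (rule nn_integral_FTC_atLeast)
    show "DERIV (\<lambda>t. - exp (- a * t) / a) t :> exp (- a * t)" for t
      using aP by (auto intro!: derivative_eq_intros)
    have "((\<lambda>t. exp (- (a * t))) \<longlongrightarrow> 0) at_top"
      using aP by (intro filterlim_compose[OF exp_at_bot] filterlim_compose[OF filterlim_uminus_at_bot_at_top]
          filterlim_tendsto_pos_mult_at_top[OF tendsto_const] filterlim_ident) auto
    from tendsto_divide[OF tendsto_minus[OF this] tendsto_const[of a]] aP
    show "((\<lambda>t. - exp (- a * t) / a) \<longlongrightarrow> 0) at_top" by simp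
  qed auto
  finally have fin: "?I < \<infinity>"
    by (rule order_le_less_trans) simp
  \<comment> \<open>Shifting the integral over the tail by one period gives back the whole integral times \<open>exp (- a P)\<close>.\<close>
  have "(\<integral>\<^sup>+t. ennreal (exp (- a * t) * h t) * indicator {P..} t \<partial>lborel)
      = (\<integral>\<^sup>+t. ennreal (exp (- a * P)) * (ennreal (exp (- a * t) * h t) * indicator {0..} t) \<partial>lborel)"
    by (subst nn_integral_real_affine[where c = 1 and t = P])
       (auto intro!: nn_integral_cong simp: h(3) add.commute[of P] ennreal_mult'[symmetric]
         exp_add[symmetric] algebra_simps split: split_indicator)
  also have "\<dots> = ennreal (exp (- a * P)) * ?I"
    by (rule nn_integral_cmult) measurable
  finally have tail: "(\<integral>\<^sup>+t. ennreal (exp (- a * t) * h t) * indicator {P..} t \<partial>lborel)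
      = ennreal (exp (- a * P)) * ?I" .
  have "?I \<le> (\<integral>\<^sup>+t. ennreal (h t) * indicator {0..P} t
      + ennreal (exp (- a * t) * h t) * indicator {P..} t \<partial>lborel)"
    using h aP by (intro nn_integral_mono)
      (auto split: split_indicator intro!: ennreal_leI mult_left_le_one_le)
  also have "\<dots> = ?G + ennreal (exp (- a * P)) * ?I"
    by (subst nn_integral_add, measurable) (simp only: tail)
  finally have rec: "?I \<le> ?G + ennreal (exp (- a * P)) * ?I" .
  show ?thesis
  proof (cases "?G = \<infinity>")
    case True
    have "0 < 1 + 1 / (a * P)" using aP by (simp add: add_pos_pos)
    then have "ennreal (1 + 1 / (a * P)) * \<infinity> = \<infinity>"
      by (simp add: ennreal_mult_top)
    then show ?thesis using True by (metis top_greatest infinity_ennreal_def)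
  next
    case False
    define i g where "i = enn2real ?I" and "g = enn2real ?G"
    have ig: "?I = ennreal i" "?G = ennreal g" "0 \<le> i" "0 \<le> g"
      using fin False by (auto simp: i_def g_def less_top)
    have "ennreal i \<le> ennreal (g + exp (- a * P) * i)"
      using rec ig by (simp add: ennreal_plus ennreal_mult)
    then have le: "i \<le> g + exp (- a * P) * i"
      using ig by (subst (asm) ennreal_le_iff) auto
    have "1 + a * P \<le> exp (a * P)"
      by (rule exp_ge_add_one_self)
    then have "(1 + a * P) * exp (- a * P) \<le> 1"
      by (simp add: exp_minus field_simps)
    then have "(a * P) * i \<le> (1 + a * P) * ((1 - exp (- a * P)) * i)"
      using ig(3) mult_right_mono[of "(1 + a * P) * exp (- a * P)" 1 i] by (simp add: algebra_simps)
    also have "\<dots> \<le> (1 + a * P) * g"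
      using le aP by (intro mult_left_mono) (auto simp: algebra_simps)
    finally have "i \<le> (1 + 1 / (a * P)) * g"
      using aP by (simp add: field_simps)
    then show ?thesis
      unfolding ig using aP ig by (subst ennreal_mult[symmetric]) (auto intro: ennreal_leI)
  qed
qed

text \<open>
As a function of \<open>t\<close> the second factor is periodic with period \<open>2 \<pi> / |x|\<close>, with peaks of width about
\<open>1 / (|x| sqrt K)\<close> at the multiples of the period; about \<open>1 + |x| / a\<close> of them contribute.
\<close>

lemma nn_integral_exp_cos_le:
  fixes a K x :: real
  assumes a: "0 < a" and K: "0 < K" and x: "x \<noteq> 0"
  shows "(\<integral>\<^sup>+t. ennreal (exp (- a * t) * exp (- K * (1 - cos (t * x)))) * indicator {0..} t \<partial>lborel)
    \<le> ennreal (8 / sqrt K * (1 / \<bar>x\<bar> + 1 / a))"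
proof -
  define y where "y = \<bar>x\<bar>"
  have y: "0 < y" and cosy: "cos (t * x) = cos (t * y)" for t
    using x by (auto simp: y_def abs_if)
  define P where "P = 2 * pi / y"
  have P: "0 < P" "P * y = 2 * pi"
    using y by (simp_all add: P_def)
  define h where "h = (\<lambda>t. exp (- K * (1 - cos (t * y))))"
  have [measurable]: "h \<in> borel_measurable borel"
    unfolding h_def by measurable
  have per: "h (t + P) = h t" for t
    using P by (simp add: h_def distrib_right)
  have le1: "h t \<le> 1" for t
    using K by (simp add: h_def)
  define c where "c = K * y\<^sup>2 / 5"
  have c: "0 < c" using K y by (simp add: c_def)
  \<comment> \<open>On one period, \<open>h\<close> has a peak at either end, each dominated by a Gaussian.\<close>
  have near: "h t \<le> exp (- c * (t - s)\<^sup>2)" if "\<bar>t - s\<bar> * y \<le> pi" "cos (t * y) = cos ((t - s) * y)" for t s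
  proof -
    have "K * ((t - s) * y)\<^sup>2 / 5 \<le> K * (1 - cos ((t - s) * y))"
      using one_minus_cos_ge[of "(t - s) * y"] that(1) K y
        mult_left_mono[of "((t - s) * y)\<^sup>2 / 5" "1 - cos ((t - s) * y)" K]
      by (simp add: abs_mult)
    moreover have "c * (t - s)\<^sup>2 = K * ((t - s) * y)\<^sup>2 / 5"
      by (simp add: c_def power_mult_distrib)
    ultimately show ?thesis
      by (simp add: h_def that(2))
  qed
  have "h t \<le> exp (- c * (t - 0)\<^sup>2) + exp (- c * (t - P)\<^sup>2)" if t: "0 \<le> t" "t \<le> P" for t
  proof (cases "t * y \<le> pi")
    case True
    with near[of t 0] t y show ?thesis
      by (intro add_increasing2) auto
  next
    case False
    have "\<bar>t - P\<bar> * y = 2 * pi - t * y"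
      using t P(2) by (simp add: abs_if algebra_simps)
    moreover have "cos ((t - P) * y) = cos (t * y - 2 * pi)"
      using P(2) by (simp add: algebra_simps)
    then have "cos ((t - P) * y) = cos (t * y)"
      by (simp add: cos_diff)
    ultimately show ?thesis
      using near[of t P] False by (intro add_increasing) auto
  qed
  then have "(\<integral>\<^sup>+t. ennreal (h t) * indicator {0..P} t \<partial>lborel)
      \<le> (\<integral>\<^sup>+t. ennreal (exp (- c * (t - 0)\<^sup>2)) + ennreal (exp (- c * (t - P)\<^sup>2)) \<partial>lborel)"
    by (intro nn_integral_mono) (auto split: split_indicator simp: ennreal_plus[symmetric] simp del: ennreal_plus intro!: ennreal_leI)
  also have "\<dots> = ennreal (2 * sqrt (pi / c))"
    using c by (subst nn_integral_add)
      (auto simp del: ennreal_plus simp: nn_integral_gaussian[of c 0, simplified] nn_integral_gaussian[of c P, simplified] ennreal_plus[symmetric])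
  finally have G: "(\<integral>\<^sup>+t. ennreal (h t) * indicator {0..P} t \<partial>lborel) \<le> ennreal (2 * sqrt (pi / c))" .
  have "(\<integral>\<^sup>+t. ennreal (exp (- a * t) * exp (- K * (1 - cos (t * x)))) * indicator {0..} t \<partial>lborel)
      = (\<integral>\<^sup>+t. ennreal (exp (- a * t) * h t) * indicator {0..} t \<partial>lborel)"
    by (simp add: h_def cosy)
  also have "\<dots> \<le> ennreal (1 + 1 / (a * P)) * ennreal (2 * sqrt (pi / c))"
    by (rule order_trans[OF nn_integral_exp_periodic_le[where h = h and P = P] mult_left_mono[OF G]])
       (use a P(1) le1 per in \<open>auto simp: h_def\<close>)
  also have "\<dots> = ennreal ((1 + 1 / (a * P)) * (2 * sqrt (pi / c)))"
    using a P c by (subst ennreal_mult) auto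
  also have "\<dots> \<le> ennreal (8 / sqrt K * (1 / \<bar>x\<bar> + 1 / a))"
  proof (rule ennreal_leI)
    have "sqrt (pi / c) = sqrt (5 * pi) / (sqrt K * y)"
      using K y by (simp add: c_def real_sqrt_divide real_sqrt_mult)
    moreover have "sqrt (5 * pi) \<le> 4"
      using pi_approx(2) by (intro real_le_lsqrt) auto
    ultimately have "sqrt (pi / c) \<le> 4 / (sqrt K * y)"
      using K y by (simp add: divide_right_mono)
    then have "(1 + 1 / (a * P)) * (2 * sqrt (pi / c)) \<le> (1 + 1 / (a * P)) * (2 * (4 / (sqrt K * y)))"
      using a P by (intro mult_left_mono) auto
    also have "\<dots> = 8 / sqrt K * (1 / y + 1 / (a * (P * y)))"
      using a P y K by (simp add: field_simps)
    also have "\<dots> \<le> 8 / sqrt K * (1 / y + 1 / a)"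
      using a K P(2) pi_gt3 by (intro mult_left_mono add_left_mono divide_left_mono) auto
    finally show "(1 + 1 / (a * P)) * (2 * sqrt (pi / c)) \<le> 8 / sqrt K * (1 / \<bar>x\<bar> + 1 / a)"
      by (simp add: y_def)
  qed
  finally show ?thesis .
qed

section \<open>Esseen's concentration inequality\<close>

lemma integral_triangle_cos:
  fixes T u :: real
  assumes "0 \<le> T" and "u \<noteq> 0"
  shows "(LINT t:{0..T}|lborel. (T - t) * cos (t * u)) = (1 - cos (T * u)) / u\<^sup>2"
proof -
  define H where "H = (\<lambda>t. (T - t) * sin (t * u) / u - cos (t * u) / u\<^sup>2)"
  have "(\<integral>t. indicator {0..T} t *\<^sub>R ((T - t) * cos (t * u)) \<partial>lborel) = H T - H 0"
  proof (rule integral_FTC_Icc)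
    fix t assume "0 \<le> t" "t \<le> T"
    have "(H has_real_derivative (T - t) * cos (t * u)) (at t)"
      unfolding H_def using assms(2)
      by (auto intro!: derivative_eq_intros simp: field_simps power2_eq_square)
    then show "(H has_vector_derivative (T - t) * cos (t * u)) (at t within {0..T})"
      by (simp add: has_real_derivative_iff_has_vector_derivative has_vector_derivative_at_within)
  qed (use assms in \<open>auto intro!: continuous_intros\<close>)
  then show ?thesis
    by (simp add: set_lebesgue_integral_def H_def diff_divide_distrib)
qed

text \<open>
The Fourier transform of a triangle is the Fejer kernel: nonnegative everywhere, and at least a fixed
fraction of its maximum near the origin.
\<close>

lemma integral_triangle_cos_bounds:
  fixes T u :: real
  assumes "0 < T"
  shows "0 \<le> (LINT t:{0..T}|lborel. (T - t) * cos (t * u))"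
    and "\<bar>T * u\<bar> \<le> pi \<Longrightarrow> T\<^sup>2 / 5 \<le> (LINT t:{0..T}|lborel. (T - t) * cos (t * u))"
proof -
  have 0: "(LINT t:{0..T}|lborel. (T - t)) = T\<^sup>2 / 2"
  proof -
    have "(\<integral>t. indicator {0..T} t *\<^sub>R (T - t) \<partial>lborel) = (T * T - T\<^sup>2 / 2) - (T * 0 - 0\<^sup>2 / 2)"
    proof (rule integral_FTC_Icc)
      fix t
      have "((\<lambda>t. T * t - t\<^sup>2 / 2) has_real_derivative T - t) (at t)"
        by (auto intro!: derivative_eq_intros)
      then show "((\<lambda>t. T * t - t\<^sup>2 / 2) has_vector_derivative T - t) (at t within {0..T})"
        by (simp add: has_real_derivative_iff_has_vector_derivative has_vector_derivative_at_within)
    qed (use assms in \<open>auto intro!: continuous_intros\<close>)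
    then show ?thesis
      by (simp add: set_lebesgue_integral_def power2_eq_square)
  qed
  show "0 \<le> (LINT t:{0..T}|lborel. (T - t) * cos (t * u))"
    using assms by (cases "u = 0") (auto simp: integral_triangle_cos 0)
  show "T\<^sup>2 / 5 \<le> (LINT t:{0..T}|lborel. (T - t) * cos (t * u))" if "\<bar>T * u\<bar> \<le> pi"
  proof (cases "u = 0")
    case True
    then show ?thesis using assms by (simp add: 0)
  next
    case False
    then have "T\<^sup>2 / 5 \<le> (1 - cos (T * u)) / u\<^sup>2"
      using one_minus_cos_ge[OF that] by (simp add: power_mult_distrib field_simps)
    then show ?thesis
      using integral_triangle_cos[of T u] assms False by simp
  qed
qed

text \<open>
An interval is dominated by a multiple of the Fejer kernel centred at its midpoint. The integral of the
kernel against \<open>G\<close> is, by Fubini, an integral of the characteristic function of \<open>G\<close> over the compact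
support of the triangle. The compact support is essential for the application, where the characteristic
function is under control only near the origin.
\<close>

lemma Esseen_concentration_inequality:
  assumes "real_distribution G" and T: "0 < T" and bT: "b * T \<le> 2 * pi"
  shows "ennreal (measure G {y..y + b})
    \<le> ennreal (5 / T) * (\<integral>\<^sup>+t. ennreal (cmod (char G t)) * indicator {0..T} t \<partial>lborel)"
proof -
  interpret G: real_distribution G by fact
  define L where "L = restrict_space lborel {0..T}"
  have L: "finite_measure L"
    using T by (intro finite_measureI) (simp add: L_def space_restrict_space emeasure_restrict_space)
  interpret L: finite_measure L by (rule L)
  interpret P: pair_sigma_finite L G ..
  have [measurable_cong]: "sets L = sets (restrict_space borel {0..T})"
    by (simp add: L_def sets_restrict_space)
  have [measurable]: "(\<lambda>t. t) \<in> borel_measurable L"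
    by (simp add: L_def measurable_restrict_space1)
  have space_L: "space L = {0..T}"
    by (simp add: L_def space_restrict_space)
  define z where "z = y + b / 2"
  define k where "k u = (LINT t:{0..T}|lborel. (T - t) * cos (t * u))" for u
  have k_L: "k u = (\<integral>t. (T - t) * cos (t * u) \<partial>L)" for u
    unfolding k_def L_def set_lebesgue_integral_def by (subst integral_restrict_space) auto
  interpret LG: finite_measure "L \<Otimes>\<^sub>M G"
    by (rule finite_measure_pair_measure) unfold_locales
  have int: "integrable (L \<Otimes>\<^sub>M G) (\<lambda>(t, x). (T - t) * cos (t * (x - z)))"
  proof (rule LG.integrable_const_bound[where B = T])
    have "\<bar>(T - t) * cos (t * (x - z))\<bar> \<le> T" if "0 \<le> t" "t \<le> T" for t x
      using mult_mono[of "\<bar>T - t\<bar>" T "\<bar>cos (t * (x - z))\<bar>" 1] that T by (simp add: abs_mult)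
    then show "AE p in L \<Otimes>\<^sub>M G. norm (case p of (t, x) \<Rightarrow> (T - t) * cos (t * (x - z))) \<le> T"
      by (intro AE_I2) (auto simp: space_pair_measure space_L)
  qed measurable
  have "T\<^sup>2 / 5 * measure G {y..y + b} = (\<integral>x. T\<^sup>2 / 5 * indicator {y..y + b} x \<partial>G)"
    by simp
  also have "\<dots> \<le> (\<integral>x. k (x - z) \<partial>G)"
  proof (rule integral_mono)
    show "integrable G (\<lambda>x. T\<^sup>2 / 5 * indicator {y..y + b} x)"
      by (rule G.integrable_const_bound[where B = "T\<^sup>2 / 5"]) (auto split: split_indicator)
    show "integrable G (\<lambda>x. k (x - z))"
      unfolding k_L using P.integrable_snd[OF int] by simp
    show "T\<^sup>2 / 5 * indicator {y..y + b} x \<le> k (x - z)" for x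
    proof (cases "x \<in> {y..y + b}")
      case True
      then have "\<bar>x - z\<bar> \<le> b / 2"
        by (auto simp: z_def abs_if field_simps)
      then have "T * \<bar>x - z\<bar> \<le> T * (b / 2)"
        using T by (intro mult_left_mono) auto
      also have "T * (b / 2) \<le> pi"
        using bT by (simp add: mult.commute)
      finally have "\<bar>T * (x - z)\<bar> \<le> pi"
        using T by (simp add: abs_mult)
      with True show ?thesis
        unfolding k_def using integral_triangle_cos_bounds(2)[OF T] by simp
    next
      case False
      then show ?thesis
        unfolding k_def using integral_triangle_cos_bounds(1)[OF T] by simp
    qed
  qed
  also have "\<dots> = (\<integral>t. (\<integral>x. (T - t) * cos (t * (x - z)) \<partial>G) \<partial>L)"
    unfolding k_L using P.Fubini_integral[OF int] by simp
  finally have "T\<^sup>2 / 5 * measure G {y..y + b} \<le> (\<integral>t. (\<integral>x. (T - t) * cos (t * (x - z)) \<partial>G) \<partial>L)" .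
  also have "\<dots> \<le> (\<integral>t. T * cmod (char G t) \<partial>L)"
  proof (rule integral_mono)
    show "integrable L (\<lambda>t. \<integral>x. (T - t) * cos (t * (x - z)) \<partial>G)"
      using P.integrable_fst[OF int] by simp
    have "cmod (char G t) * T \<le> T" for t
      using mult_right_mono[OF G.cmod_char_le_1, of T t] T by simp
    then show "integrable L (\<lambda>t. T * cmod (char G t))"
      using T by (intro L.integrable_const_bound[where B = T]) (auto simp: mult.commute)
    show "(\<integral>x. (T - t) * cos (t * (x - z)) \<partial>G) \<le> T * cmod (char G t)" if "t \<in> space L" for t
    proof -
      have "(\<integral>x. (T - t) * cos (t * (x - z)) \<partial>G) = (T - t) * Re (cis (- (t * z)) * char G t)"
        using integral_cos_shift[OF assms(1), of t "t * z"] by (simp add: right_diff_distrib)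
      also have "\<dots> \<le> (T - t) * cmod (char G t)"
        using that complex_Re_le_cmod[of "cis (- (t * z)) * char G t"]
        by (intro mult_left_mono) (auto simp: space_L norm_mult)
      also have "\<dots> \<le> T * cmod (char G t)"
        using that by (intro mult_right_mono) (auto simp: space_L)
      finally show ?thesis .
    qed
  qed
  finally have main: "T\<^sup>2 / 5 * measure G {y..y + b} \<le> T * (\<integral>t. cmod (char G t) \<partial>L)"
    by simp
  then have "measure G {y..y + b} \<le> 5 / T * (\<integral>t. cmod (char G t) \<partial>L)"
    using T by (simp add: field_simps power2_eq_square)
  then have "ennreal (measure G {y..y + b}) \<le> ennreal (5 / T) * ennreal (\<integral>t. cmod (char G t) \<partial>L)"
    using T by (subst ennreal_mult[symmetric]) (auto intro: ennreal_leI Bochner_Integration.integral_nonneg)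
  also have "ennreal (\<integral>t. cmod (char G t) \<partial>L) = (\<integral>\<^sup>+t. ennreal (cmod (char G t)) \<partial>L)"
    using G.cmod_char_le_1
    by (intro nn_integral_eq_integral[symmetric] L.integrable_const_bound[where B = 1]) auto
  also have "\<dots> = (\<integral>\<^sup>+t. ennreal (cmod (char G t)) * indicator {0..T} t \<partial>lborel)"
    unfolding L_def by (subst nn_integral_restrict_space) auto
  finally show ?thesis .
qed

section \<open>Exponentials of the symmetrized characteristic function\<close>

lemma integrable_truncated_square:
  fixes S :: "real measure" and r :: real
  assumes "real_distribution S"
  shows "integrable S (\<lambda>x. min (x\<^sup>2 / r\<^sup>2) 1)"
proof -
  interpret real_distribution S by fact
  show ?thesis
    by (rule integrable_const_bound[where B = 1]) auto
qed

text \<open>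
Jensen's inequality for the probability density \<open>w\<close> with respect to \<open>S\<close>, proved by integrating a tangent
of the exponential. The weight \<open>w\<close> is proportional to the integrand of \<^const>\<open>truncated_moment\<close>: with
this choice the remaining integral over \<open>t\<close> has a bound that is uniform in \<open>x\<close>. At \<open>x = 0\<close> both
\<open>w x\<close> and \<open>1 - cos (t x)\<close> vanish, so the value \<open>N / 0 = 0\<close> does no harm.
\<close>

lemma exp_integral_one_minus_cos_le:
  fixes S :: "real measure" and r N t :: real
  assumes "real_distribution S" and r: "0 < r" and N: "0 \<le> N" and D: "0 < truncated_moment S r"
  defines "w \<equiv> \<lambda>x. min (x\<^sup>2 / r\<^sup>2) 1 / truncated_moment S r"
  shows "ennreal (exp (- N * (\<integral>x. 1 - cos (t * x) \<partial>S)))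
    \<le> (\<integral>\<^sup>+x. ennreal (w x) * ennreal (exp (- (N / w x) * (1 - cos (t * x)))) \<partial>S)"
proof -
  interpret real_distribution S by fact
  define A where "A = N * (\<integral>x. 1 - cos (t * x) \<partial>S)"
  have w: "0 \<le> w x" "w x = 0 \<longleftrightarrow> x = 0" for x
    using r D by (auto simp: w_def min_def)
  have int_w: "integrable S w"
    unfolding w_def by (intro integrable_divide integrable_truncated_square assms(1))
  have total: "(\<integral>x. w x \<partial>S) = 1"
    using D by (simp add: w_def truncated_moment_def)
  have int_c: "integrable S (\<lambda>x. 1 - cos (t * x))"
    using integrable_cos[OF assms(1)] by simp
  \<comment> \<open>The tangent of the exponential at \<open>- A\<close>, multiplied by \<open>w\<close>; its integral is \<open>exp (- A)\<close>.\<close>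
  define g where "g = (\<lambda>x. exp (- A) * ((1 + A) * w x - N * (1 - cos (t * x))))"
  have int_g: "integrable S g"
    unfolding g_def using int_w int_c by simp
  have "(\<integral>x. g x \<partial>S) = exp (- A) * ((1 + A) * (\<integral>x. w x \<partial>S) - N * (\<integral>x. 1 - cos (t * x) \<partial>S))"
    unfolding g_def using int_w int_c by simp
  then have g: "(\<integral>x. g x \<partial>S) = exp (- A)"
    by (simp add: total A_def)
  have tangent: "g x \<le> w x * exp (- (N / w x) * (1 - cos (t * x)))" for x
  proof (cases "x = 0")
    case True
    then show ?thesis using w(2)[of 0] by (simp add: g_def)
  next
    case False
    then have pos: "0 < w x" using w[of x] by linarith
    define q where "q = (N / w x) * (1 - cos (t * x))"
    have "g x = w x * (exp (- A) * (1 + (A - q)))"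
      using pos by (simp add: g_def q_def field_simps)
    also have "\<dots> \<le> w x * (exp (- A) * exp (A - q))"
      using pos by (intro mult_left_mono exp_ge_add_one_self) auto
    finally show ?thesis
      by (simp add: exp_add[symmetric] q_def)
  qed
  have bound: "w x * exp (- (N / w x) * (1 - cos (t * x))) \<le> w x" for x
    using w(1)[of x] N by (intro mult_left_le) auto
  have [measurable]: "w \<in> borel_measurable S"
    using int_w by auto
  have int_e: "integrable S (\<lambda>x. w x * exp (- (N / w x) * (1 - cos (t * x))))"
    using w bound by (intro Bochner_Integration.integrable_bound[OF int_w]) (auto simp: abs_mult)
  have "exp (- A) \<le> (\<integral>x. w x * exp (- (N / w x) * (1 - cos (t * x))) \<partial>S)"
    unfolding g[symmetric] by (rule integral_mono[OF int_g int_e tangent])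
  then have "ennreal (exp (- A)) \<le> ennreal (\<integral>x. w x * exp (- (N / w x) * (1 - cos (t * x))) \<partial>S)"
    by (rule ennreal_leI)
  also have "\<dots> = (\<integral>\<^sup>+x. ennreal (w x * exp (- (N / w x) * (1 - cos (t * x)))) \<partial>S)"
    using w by (intro nn_integral_eq_integral[symmetric] int_e) auto
  also have "\<dots> = (\<integral>\<^sup>+x. ennreal (w x) * ennreal (exp (- (N / w x) * (1 - cos (t * x)))) \<partial>S)"
    using w by (simp add: ennreal_mult)
  finally show ?thesis by (simp add: A_def)
qed

text \<open>
After Jensen's inequality and Tonelli's theorem, \<open>nn_integral_exp_cos_le\<close> bounds the integral for each \<open>x\<close>, with
\<open>K = N D / m\<close>, \<open>m = min (x\<^sup>2 / r\<^sup>2) 1\<close> and \<open>D\<close> the truncated moment. As \<open>sqrt m\<close> is at most \<open>1\<close> and at most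
\<open>|x| / r\<close>, the dependence on \<open>x\<close> cancels: \<open>sqrt m * (1 / |x| + 1 / a) \<le> 1 / r + 1 / a\<close>.
\<close>

lemma nn_integral_exp_symmetric_le:
  fixes S :: "real measure" and r N a :: real
  assumes S: "real_distribution S" and r: "0 < r" and N: "0 < N" and a: "0 < a"
    and D: "0 < truncated_moment S r"
  shows "(\<integral>\<^sup>+t. ennreal (exp (- a * t) * exp (- N * (\<integral>x. 1 - cos (t * x) \<partial>S))) * indicator {0..} t \<partial>lborel)
    \<le> ennreal (8 / sqrt (N * truncated_moment S r) * (1 / r + 1 / a))"
proof -
  interpret real_distribution S by fact
  interpret P: pair_sigma_finite lborel S ..
  define D where "D = truncated_moment S r"
  define w where "w = (\<lambda>x. min (x\<^sup>2 / r\<^sup>2) 1 / D)"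
  define E where "E = (\<lambda>t. ennreal (exp (- a * t)) * indicator {0..} t)"
  define e where "e = (\<lambda>t x. ennreal (exp (- (N / w x) * (1 - cos (t * x)))))"
  define B where "B = 8 / sqrt (N * D) * (1 / r + 1 / a)"
  have D: "0 < D" using assms by (simp add: D_def)
  have w: "0 \<le> w x" for x using D by (simp add: w_def)
  have [measurable]: "w \<in> borel_measurable borel" "E \<in> borel_measurable borel"
    by (auto simp: w_def E_def)
  have [measurable]: "case_prod e \<in> borel_measurable (lborel \<Otimes>\<^sub>M S)"
    unfolding e_def by measurable
  have slice: "ennreal (w x) * (\<integral>\<^sup>+t. E t * e t x \<partial>lborel) \<le> ennreal (w x) * ennreal B" for x
  proof (cases "x = 0")
    case True
    then show ?thesis by (simp add: w_def)
  next
    case False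
    define m where "m = min (x\<^sup>2 / r\<^sup>2) 1"
    have m: "0 < m" "w x = m / D" using False r by (simp_all add: m_def w_def)
    then have wx: "0 < w x" using D by simp
    have sqrt_m: "sqrt m \<le> \<bar>x\<bar> / r" "sqrt m \<le> 1"
      using r by (auto simp: m_def real_sqrt_divide intro!: real_le_lsqrt simp: power_divide)
    have "(\<integral>\<^sup>+t. E t * e t x \<partial>lborel)
        = (\<integral>\<^sup>+t. ennreal (exp (- a * t) * exp (- (N / w x) * (1 - cos (t * x)))) * indicator {0..} t \<partial>lborel)"
      by (simp add: E_def e_def ennreal_mult mult_ac)
    also have "\<dots> \<le> ennreal (8 / sqrt (N / w x) * (1 / \<bar>x\<bar> + 1 / a))"
      using a N wx False by (intro nn_integral_exp_cos_le) auto
    also have "\<dots> \<le> ennreal B"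
    proof (rule ennreal_leI)
      have "8 / sqrt (N / w x) = 8 / sqrt (N * D) * sqrt m"
        using m D N by (simp add: m(2) real_sqrt_divide real_sqrt_mult)
      then have "8 / sqrt (N / w x) * (1 / \<bar>x\<bar> + 1 / a)
          = 8 / sqrt (N * D) * (sqrt m * (1 / \<bar>x\<bar>) + sqrt m * (1 / a))"
        by (simp only: distrib_left mult.assoc)
      also have "\<dots> \<le> 8 / sqrt (N * D) * (\<bar>x\<bar> / r * (1 / \<bar>x\<bar>) + 1 * (1 / a))"
        using sqrt_m a N D by (intro mult_left_mono add_mono mult_right_mono) auto
      finally show "8 / sqrt (N / w x) * (1 / \<bar>x\<bar> + 1 / a) \<le> B"
        using False by (simp add: B_def)
    qed
    finally show ?thesis by (rule mult_left_mono) simp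
  qed
  have "(\<integral>\<^sup>+t. ennreal (exp (- a * t) * exp (- N * (\<integral>x. 1 - cos (t * x) \<partial>S))) * indicator {0..} t \<partial>lborel)
      \<le> (\<integral>\<^sup>+t. E t * (\<integral>\<^sup>+x. ennreal (w x) * e t x \<partial>S) \<partial>lborel)"
  proof (rule nn_integral_mono)
    fix t
    have "ennreal (exp (- N * (\<integral>x. 1 - cos (t * x) \<partial>S))) \<le> (\<integral>\<^sup>+x. ennreal (w x) * e t x \<partial>S)"
      using exp_integral_one_minus_cos_le[OF S r, of N t] N assms(5)
      unfolding w_def e_def D_def by simp
    then have "E t * ennreal (exp (- N * (\<integral>x. 1 - cos (t * x) \<partial>S))) \<le> E t * (\<integral>\<^sup>+x. ennreal (w x) * e t x \<partial>S)"
      by (rule mult_left_mono) simp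
    then show "ennreal (exp (- a * t) * exp (- N * (\<integral>x. 1 - cos (t * x) \<partial>S))) * indicator {0..} t
        \<le> E t * (\<integral>\<^sup>+x. ennreal (w x) * e t x \<partial>S)"
      by (simp add: E_def ennreal_mult mult_ac)
  qed
  also have "\<dots> = (\<integral>\<^sup>+t. \<integral>\<^sup>+x. E t * (ennreal (w x) * e t x) \<partial>S \<partial>lborel)"
    by (intro nn_integral_cong nn_integral_cmult[symmetric]) measurable
  also have "\<dots> = (\<integral>\<^sup>+x. \<integral>\<^sup>+t. E t * (ennreal (w x) * e t x) \<partial>lborel \<partial>S)"
    by (rule P.Fubini'[symmetric]) measurable
  also have "\<dots> = (\<integral>\<^sup>+x. ennreal (w x) * (\<integral>\<^sup>+t. E t * e t x \<partial>lborel) \<partial>S)"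
    by (intro nn_integral_cong, subst nn_integral_cmult[symmetric]) (auto simp: mult_ac)
  also have "\<dots> \<le> (\<integral>\<^sup>+x. ennreal (w x) * ennreal B \<partial>S)"
    by (rule nn_integral_mono) (rule slice)
  also have "\<dots> = ennreal B * (\<integral>\<^sup>+x. ennreal (w x) \<partial>S)"
    by (subst nn_integral_cmult[symmetric]) (auto simp: mult.commute)
  also have "(\<integral>\<^sup>+x. ennreal (w x) \<partial>S) = ennreal (\<integral>x. w x \<partial>S)"
    using w unfolding w_def
    by (intro nn_integral_eq_integral integrable_divide integrable_truncated_square S) auto
  also have "(\<integral>x. w x \<partial>S) = 1"
    using D by (simp add: w_def D_def truncated_moment_def)
  finally show ?thesis by (simp add: B_def D_def)
qed

section \<open>The smoothing component\<close>

lemma integrable_square_min: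
  fixes U :: "real measure" and R :: real
  assumes "real_distribution U" and int: "integrable U (\<lambda>x. x\<^sup>2)" and R: "0 \<le> R"
  shows "integrable U (\<lambda>x. x\<^sup>2 * min \<bar>x\<bar> R)"
proof -
  interpret real_distribution U by fact
  show ?thesis
  proof (rule Bochner_Integration.integrable_bound)
    show "integrable U (\<lambda>x. R * x\<^sup>2)"
      using int by simp
    show "AE x in U. norm (x\<^sup>2 * min \<bar>x\<bar> R) \<le> norm (R * x\<^sup>2)"
      using R by (intro AE_I2) (auto simp: abs_mult mult.commute[of R] intro!: mult_left_mono)
  qed measurable
qed

text \<open>
At most a quarter of the second moment comes from \<open>|x| < \<sigma> / 2\<close>. For \<open>R = \<sigma> sqrt n\<close> this bounds
\<open>\<kappa> / \<sigma>\<^sup>2\<close> below by a multiple of \<open>\<sigma>\<close>; frequencies of order \<open>\<sigma>\<^sup>2 / \<kappa>\<close> are therefore at most of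
order \<open>1 / \<sigma>\<close>.
\<close>

lemma square_min_integral_ge:
  fixes U :: "real measure" and \<sigma> R :: real
  assumes U: "real_distribution U" and int: "integrable U (\<lambda>x. x\<^sup>2)"
    and var: "\<sigma>\<^sup>2 = (\<integral>x. x\<^sup>2 \<partial>U)" and s: "0 < \<sigma>" "\<sigma> \<le> R"
  shows "3 / 8 * \<sigma> ^ 3 \<le> (\<integral>x. x\<^sup>2 * min \<bar>x\<bar> R \<partial>U)"
proof -
  interpret real_distribution U by fact
  have "(\<integral>x. \<sigma> / 2 * (x\<^sup>2 - \<sigma>\<^sup>2 / 4) \<partial>U) \<le> (\<integral>x. x\<^sup>2 * min \<bar>x\<bar> R \<partial>U)"
  proof (rule integral_mono)
    show "integrable U (\<lambda>x. x\<^sup>2 * min \<bar>x\<bar> R)"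
      using s by (intro integrable_square_min U int) auto
    show "\<sigma> / 2 * (x\<^sup>2 - \<sigma>\<^sup>2 / 4) \<le> x\<^sup>2 * min \<bar>x\<bar> R" for x
    proof (cases "\<bar>x\<bar> \<ge> \<sigma> / 2")
      case True
      have "\<sigma> / 2 * (x\<^sup>2 - \<sigma>\<^sup>2 / 4) \<le> x\<^sup>2 * (\<sigma> / 2)"
        using s by (simp add: algebra_simps)
      also have "\<dots> \<le> x\<^sup>2 * min \<bar>x\<bar> R"
        using True s by (intro mult_left_mono) auto
      finally show ?thesis .
    next
      case False
      then have "\<bar>x\<bar>\<^sup>2 \<le> (\<sigma> / 2)\<^sup>2"
        by (intro power_mono) auto
      then have "\<sigma> / 2 * (x\<^sup>2 - \<sigma>\<^sup>2 / 4) \<le> 0"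
        using s by (intro mult_nonneg_nonpos) (auto simp: power_divide)
      also have "0 \<le> x\<^sup>2 * min \<bar>x\<bar> R"
        using s by (intro mult_nonneg_nonneg) auto
      finally show ?thesis .
    qed
  qed (use int in auto)
  also have "(\<integral>x. \<sigma> / 2 * (x\<^sup>2 - \<sigma>\<^sup>2 / 4) \<partial>U) = \<sigma> / 2 * (\<sigma>\<^sup>2 - \<sigma>\<^sup>2 / 4)"
    using int prob_space by (simp add: var)
  finally show ?thesis
    by (simp add: power2_eq_square power3_eq_cube)
qed

text \<open>
In the Taylor bound for the characteristic function, the remainder \<open>min (6 x\<^sup>2) (t |x|\<^sup>3)\<close> is at most
\<open>6 t x\<^sup>2 min |x| R\<close> as soon as \<open>t R \<ge> 1\<close>. So a third moment truncated at \<open>R\<close> suffices, and the smallness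
assumption on \<open>t\<close> lets the remainder consume at most half of the quadratic term.
\<close>

lemma norm_char_le_quadratic:
  fixes U :: "real measure" and \<sigma> R t :: real
  assumes U: "real_distribution U" and int: "integrable U (\<lambda>x. x\<^sup>2)"
    and var: "\<sigma>\<^sup>2 = (\<integral>x. x\<^sup>2 \<partial>U)" and mean: "(\<integral>x. x \<partial>U) = 0"
    and tR: "0 \<le> t" "1 \<le> t * R"
    and t_kappa: "4 * t * (\<integral>x. x\<^sup>2 * min \<bar>x\<bar> R \<partial>U) \<le> \<sigma>\<^sup>2" and ts: "(t * \<sigma>)\<^sup>2 \<le> 2"
  shows "cmod (char U t) \<le> 1 - (t * \<sigma>)\<^sup>2 / 4"
proof -
  interpret real_distribution U by fact
  have int1: "integrable U (\<lambda>x. x)"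
    by (rule square_integrable_imp_integrable) (use int in auto)
  have R: "0 \<le> R"
    using tR by (metis mult_nonneg_nonpos nle_le not_one_le_zero order_trans)
  have int3: "integrable U (\<lambda>x. x\<^sup>2 * min \<bar>x\<bar> R)"
    by (rule integrable_square_min[OF U int R])
  have "variance (\<lambda>x. x) = \<sigma>\<^sup>2"
    by (simp add: mean var)
  from char_approx3[OF int1 mean int this, of t]
  have "cmod (char U t - (1 - t\<^sup>2 * \<sigma>\<^sup>2 / 2))
      \<le> t\<^sup>2 / 6 * (\<integral>x. min (6 * x\<^sup>2) (\<bar>t\<bar> * \<bar>x\<bar> ^ 3) \<partial>U)" .
  also have "\<dots> \<le> t\<^sup>2 / 6 * (\<integral>x. 6 * t * (x\<^sup>2 * min \<bar>x\<bar> R) \<partial>U)"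
  proof (intro mult_left_mono integral_mono)
    show "integrable U (\<lambda>x. 6 * t * (x\<^sup>2 * min \<bar>x\<bar> R))"
      using int3 by simp
    show "integrable U (\<lambda>x. min (6 * x\<^sup>2) (\<bar>t\<bar> * \<bar>x\<bar> ^ 3))"
      by (rule Bochner_Integration.integrable_bound[where f = "\<lambda>x. 6 * x\<^sup>2"]) (use int in auto)
    show "min (6 * x\<^sup>2) (\<bar>t\<bar> * \<bar>x\<bar> ^ 3) \<le> 6 * t * (x\<^sup>2 * min \<bar>x\<bar> R)" for x
    proof (cases "\<bar>x\<bar> \<le> R")
      case True
      have "\<bar>x\<bar> ^ 3 = x\<^sup>2 * \<bar>x\<bar>"
        by (simp add: power3_eq_cube power2_eq_square)
      then have "\<bar>t\<bar> * \<bar>x\<bar> ^ 3 = 1 * (t * (x\<^sup>2 * \<bar>x\<bar>))"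
        using tR by simp
      also have "\<dots> \<le> 6 * (t * (x\<^sup>2 * \<bar>x\<bar>))"
        using tR by (intro mult_right_mono) auto
      finally show ?thesis
        using True by (simp add: min_absorb1 min.coboundedI2)
    next
      case False
      have "6 * x\<^sup>2 * 1 \<le> 6 * x\<^sup>2 * (t * R)"
        using tR by (intro mult_left_mono) auto
      with False show ?thesis
        by (simp add: min_absorb2 min.coboundedI1 mult_ac)
    qed
  qed simp
  also have "\<dots> = t\<^sup>2 / 4 * (4 * t * (\<integral>x. x\<^sup>2 * min \<bar>x\<bar> R \<partial>U))"
    by simp
  also have "\<dots> \<le> t\<^sup>2 / 4 * \<sigma>\<^sup>2"
    using t_kappa by (intro mult_left_mono) auto
  finally have "cmod (char U t - of_real (1 - t\<^sup>2 * \<sigma>\<^sup>2 / 2)) \<le> t\<^sup>2 * \<sigma>\<^sup>2 / 4"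
    by simp
  then have "cmod (char U t) \<le> \<bar>1 - t\<^sup>2 * \<sigma>\<^sup>2 / 2\<bar> + t\<^sup>2 * \<sigma>\<^sup>2 / 4"
    using norm_triangle_sub[of "char U t" "of_real (1 - t\<^sup>2 * \<sigma>\<^sup>2 / 2)"]
    unfolding norm_of_real by linarith
  then show ?thesis
    using ts by (simp add: power_mult_distrib mult.commute)
qed

section \<open>Nondegeneracy\<close>

text \<open>
The bound to be proved has the truncated moment in a denominator, where \<open>1 / 0 = 0\<close> would make it false.
If the moment vanished, two independent copies of \<open>F\<close> would agree almost surely,
and \<open>F\<close> would be a point mass.
\<close>

lemma truncated_moment_symmetrized_pos:
  fixes F :: "real measure" and r :: real
  assumes F: "real_distribution F" and r: "0 < r"
    and nondeg: "\<And>c. measure F {c} \<noteq> 1"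
  shows "0 < truncated_moment (symmetrized F) r"
proof -
  interpret F: real_distribution F by fact
  let ?S = "symmetrized F" and ?F' = "distr F borel uminus"
  interpret F': real_distribution ?F'
    by (rule real_distribution_uminus[OF F])
  have S: "real_distribution ?S"
    by (rule real_distribution_symmetrized[OF F])
  then interpret S: real_distribution ?S .
  have nonneg: "0 \<le> min (x\<^sup>2 / r\<^sup>2) 1" for x
    by simp
  have compl: "(\<integral>\<^sup>+y. indicator (- {0}) (x + - y) \<partial>F) = emeasure F (- {x})" for x
  proof -
    have "(\<lambda>y. indicator (- {0}) (x + - y) :: ennreal) = indicator (- {x})"
      by (auto simp: indicator_def)
    then show ?thesis by simp
  qed
  have False if zero: "truncated_moment ?S r = 0"
  proof -
    have "AE x in ?S. min (x\<^sup>2 / r\<^sup>2) 1 = 0"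
      using zero integral_nonneg_eq_0_iff_AE[OF integrable_truncated_square[OF S, of r]] nonneg
      by (simp add: truncated_moment_def)
    then have "AE x in ?S. x = 0"
      by eventually_elim (use r in \<open>auto simp: min_def split: if_splits\<close>)
    then have "(\<integral>\<^sup>+x. indicator (- {0}) x \<partial>?S) = 0"
      by (subst nn_integral_0_iff_AE) (auto simp: indicator_def)
    also have "(\<integral>\<^sup>+x. indicator (- {0}) x \<partial>?S) = (\<integral>\<^sup>+x. \<integral>\<^sup>+y. indicator (- {0}) (x + y) \<partial>?F' \<partial>F)"
      unfolding symmetrized_def
      by (intro nn_integral_convolution F.finite_measure_axioms F'.finite_measure_axioms) auto
    also have "\<dots> = (\<integral>\<^sup>+x. \<integral>\<^sup>+y. indicator (- {0}) (x + - y) \<partial>F \<partial>F)"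
      by (intro nn_integral_cong) (subst nn_integral_distr; simp)
    finally have 0: "(\<integral>\<^sup>+x. \<integral>\<^sup>+y. indicator (- {0}) (x + - y) \<partial>F \<partial>F) = 0" .
    have "emeasure F (- {x}) = ennreal (1 - measure F {x})" for x
      using F.prob_compl[of "{x}"] by (simp add: F.emeasure_eq_measure Compl_eq_Diff_UNIV)
    then have pos: "emeasure F (- {x}) \<noteq> 0" for x
      using nondeg[of x] by simp
    have "AE x in F. (\<integral>\<^sup>+y. indicator (- {0}) (x + - y) \<partial>F) = 0"
      using 0 by (subst (asm) nn_integral_0_iff_AE) auto
    with pos have "AE x in F. False" by (simp only: compl)
    then show False
      using F.AE_False by simp
  qed
  moreover have "0 \<le> truncated_moment ?S r"
    unfolding truncated_moment_def by (rule Bochner_Integration.integral_nonneg) simp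
  ultimately show ?thesis by fastforce
qed

lemma mixture_not_point_mass:
  fixes F U V :: "real measure"
  assumes "real_distribution F" and U: "real_distribution U" and V: "real_distribution V"
    and p: "0 < p" "p < 1" and mix: "is_mixture p U V F"
    and mean: "(\<integral>x. x \<partial>U) = 0" and var: "0 < (\<integral>x. x\<^sup>2 \<partial>U)"
  shows "measure F {c} \<noteq> 1"
proof
  interpret U: real_distribution U by fact
  interpret V: real_distribution V by fact
  assume "measure F {c} = 1"
  then have eq: "1 = (1 - p) * measure U {c} + p * measure V {c}"
    using mix by (simp add: is_mixture_def)
  have "p * measure V {c} \<le> p"
    using p by (simp add: mult_left_le)
  with eq have "(1 - p) * 1 \<le> (1 - p) * measure U {c}"
    by simp
  then have "1 \<le> measure U {c}"
    by (rule mult_left_le_imp_le) (use p in simp)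
  then have "measure U {c} = 1"
    using U.prob_le_1[of "{c}"] by linarith
  then have AE: "AE x in U. x = c"
    using U.prob_eq_1[of "{c}"] by simp
  have "(\<integral>x. x \<partial>U) = (\<integral>x. c \<partial>U)"
    by (rule integral_cong_AE) (use AE in auto)
  then have "c = 0"
    using mean U.prob_space by simp
  have "(\<integral>x. x\<^sup>2 \<partial>U) = (\<integral>x. c\<^sup>2 \<partial>U)"
    by (rule integral_cong_AE) (use AE in auto)
  with var \<open>c = 0\<close> show False by simp
qed

section \<open>The concentration bound\<close>

text \<open>
Two bounds hold for \<open>f = |char F t|\<close>: one from \<open>f\<^sup>2 \<le> exp (- (1 - f\<^sup>2))\<close>, which sees all of \<open>F\<close>, and a
Gaussian one, of scale \<open>\<sigma> sqrt (n (1 - p))\<close>, coming from the component \<open>U\<close>. Their geometric mean keeps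
half of either exponent. For \<open>t \<sigma> sqrt n < 1\<close> the characteristic function of \<open>U\<close> is not controlled, but
there the Gaussian factor is bounded below, so that \<open>f\<^sup>n \<le> 1\<close> is enough; this costs the constant
\<open>exp (1 / 4)\<close>. Finally the Gaussian is replaced by an exponential, to which the results on Laplace
transforms apply.
\<close>

lemma power_char_le:
  fixes F U V :: "real measure" and n :: nat
  assumes F: "real_distribution F" and U: "real_distribution U" and V: "real_distribution V"
    and p: "0 < p" "p < 1" and mix: "is_mixture p U V F"
    and n: "1 \<le> n" and s: "0 < \<sigma>"
    and int: "integrable U (\<lambda>x. x\<^sup>2)" and var: "\<sigma>\<^sup>2 = (\<integral>x. x\<^sup>2 \<partial>U)" and mean: "(\<integral>x. x \<partial>U) = 0"
    and t: "0 \<le> t" "4 * t * kappa U \<sigma> n \<le> \<sigma>\<^sup>2"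
  shows "cmod (char F t) ^ n \<le> 2 * (exp (- (\<sigma> * sqrt (real n * (1 - p)) / 2) * t)
    * exp (- (real n / 4) * (\<integral>x. 1 - cos (t * x) \<partial>(symmetrized F))))"
proof -
  define f where "f = cmod (char F t)"
  define q where "q = (1 - p) * (t * \<sigma>)\<^sup>2"
  define a where "a = \<sigma> * sqrt (real n * (1 - p)) / 2"
  have f: "0 \<le> f" by (simp add: f_def)
  have at: "(a * t)\<^sup>2 = real n * q / 4"
    using p n by (simp add: a_def q_def power_mult_distrib power_divide)
  have sq: "f\<^sup>2 \<le> exp (- (1 - f\<^sup>2))"
    using exp_ge_add_one_self[of "- (1 - f\<^sup>2)"] by simp
  have sym: "f ^ n \<le> exp (- (real n / 2) * (1 - f\<^sup>2))"
  proof (rule power2_le_imp_le)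
    have "(f ^ n)\<^sup>2 = (f\<^sup>2) ^ n"
      by (simp add: power_mult[symmetric] mult.commute)
    also have "\<dots> \<le> exp (- (1 - f\<^sup>2)) ^ n"
      using sq by (rule power_mono) simp
    also have "\<dots> = (exp (- (real n / 2) * (1 - f\<^sup>2)))\<^sup>2"
      by (simp add: exp_of_nat_mult[symmetric] exp_double[symmetric] algebra_simps)
    finally show "(f ^ n)\<^sup>2 \<le> (exp (- (real n / 2) * (1 - f\<^sup>2)))\<^sup>2" .
  qed simp
  have gauss: "f ^ n \<le> exp (1 / 4 - real n * q / 4)"
  proof (cases "1 \<le> t * (\<sigma> * sqrt (real n))")
    case True
    have "\<sigma> \<le> \<sigma> * sqrt (real n)"
      using s n by simp
    from square_min_integral_ge[OF U int var s this] have "3 / 8 * \<sigma> ^ 3 \<le> kappa U \<sigma> n"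
      by (simp add: kappa_def)
    then have "4 * t * (3 / 8 * \<sigma> ^ 3) \<le> 4 * t * kappa U \<sigma> n"
      using t by (intro mult_left_mono) auto
    then have "(3 / 2 * (t * \<sigma>)) * \<sigma>\<^sup>2 \<le> 1 * \<sigma>\<^sup>2"
      using t(2) by (simp add: power2_eq_square power3_eq_cube algebra_simps)
    then have "3 / 2 * (t * \<sigma>) \<le> 1"
      by (rule mult_right_le_imp_le) (use s in simp)
    then have "(t * \<sigma>)\<^sup>2 \<le> 1\<^sup>2"
      using t s by (intro power_mono) auto
    then have "cmod (char U t) \<le> 1 - (t * \<sigma>)\<^sup>2 / 4"
      using t True by (intro norm_char_le_quadratic[OF U int var mean, of t "\<sigma> * sqrt (real n)"])
        (auto simp: kappa_def)
    then have "(1 - p) * cmod (char U t) + p \<le> (1 - p) * (1 - (t * \<sigma>)\<^sup>2 / 4) + p"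
      using p by (intro add_right_mono mult_left_mono) auto
    with norm_char_mixture_le[OF F U V p mix, of t]
    have "f \<le> (1 - p) * (1 - (t * \<sigma>)\<^sup>2 / 4) + p"
      unfolding f_def by linarith
    also have "\<dots> = 1 + - q / 4"
      by (simp add: q_def field_simps)
    also have "\<dots> \<le> exp (- q / 4)"
      by (rule exp_ge_add_one_self)
    finally have "f ^ n \<le> exp (- q / 4) ^ n"
      using f by (intro power_mono) auto
    also have "\<dots> = exp (- real n * q / 4)"
      by (simp add: exp_of_nat_mult[symmetric])
    also have "\<dots> \<le> exp (1 / 4 - real n * q / 4)"
      by simp
    finally show ?thesis .
  next
    case False
    then have "(t * (\<sigma> * sqrt (real n)))\<^sup>2 \<le> 1\<^sup>2"
      using t s by (intro power_mono) auto
    then have "real n * (t * \<sigma>)\<^sup>2 \<le> 1"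
      by (simp add: power_mult_distrib mult_ac)
    moreover have "real n * q \<le> real n * (t * \<sigma>)\<^sup>2"
      using p by (auto simp: q_def intro!: mult_left_mono mult_left_le_one_le)
    ultimately have "1 \<le> exp (1 / 4 - real n * q / 4)"
      by simp
    moreover have "f ^ n \<le> 1"
      using f real_distribution.cmod_char_le_1[OF F, of t] by (intro power_le_one) (auto simp: f_def)
    ultimately show ?thesis by linarith
  qed
  have "(f ^ n)\<^sup>2 \<le> exp (1 / 4 - real n * q / 4) * exp (- (real n / 2) * (1 - f\<^sup>2))"
    unfolding power2_eq_square[of "f ^ n"] using gauss sym f by (intro mult_mono) auto
  also have "\<dots> \<le> (2 * (exp (- a * t) * exp (- (real n / 4) * (1 - f\<^sup>2))))\<^sup>2"
  proof -
    \<comment> \<open>A Gaussian is at most a constant times an exponential of the same scale.\<close>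
    have "2 * (a * t) \<le> 1 + (a * t)\<^sup>2"
      using sum_squares_bound[of 1 "a * t"] by simp
    then have "exp (1 / 4 - real n * q / 4) \<le> exp (5 / 4 + - a * t + - a * t)"
      using at by simp
    also have "\<dots> = exp (5 / 4) * (exp (- a * t))\<^sup>2"
      by (simp only: exp_add power2_eq_square mult.assoc)
    also have "\<dots> \<le> 4 * (exp (- a * t))\<^sup>2"
    proof (rule mult_right_mono)
      have "exp (5 / 4 :: real) ^ 4 = exp 1 ^ 5"
        by (simp add: exp_of_nat_mult[symmetric])
      also have "\<dots> \<le> (3 :: real) ^ 5"
        using exp_le by (intro power_mono) auto
      also have "\<dots> \<le> 4 ^ 4" by simp
      finally show "exp (5 / 4 :: real) \<le> 4"
        using power_le_imp_le_base[of "exp (5 / 4 :: real)" 3 4] by simp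
    qed simp
    finally have "exp (1 / 4 - real n * q / 4) * exp (- (real n / 2) * (1 - f\<^sup>2))
        \<le> 4 * (exp (- a * t))\<^sup>2 * exp (- (real n / 2) * (1 - f\<^sup>2))"
      by (rule mult_right_mono) simp
    also have "4 * (exp (- a * t))\<^sup>2 * exp (- (real n / 2) * (1 - f\<^sup>2))
        = (2 * (exp (- a * t) * exp (- (real n / 4) * (1 - f\<^sup>2))))\<^sup>2"
    proof -
      have "exp (- (real n / 2) * (1 - f\<^sup>2)) = (exp (- (real n / 4) * (1 - f\<^sup>2)))\<^sup>2"
        by (simp add: exp_double[symmetric])
      then show ?thesis
        by (simp only: power_mult_distrib mult.assoc) simp
    qed
    finally show ?thesis .
  qed
  finally have "f ^ n \<le> 2 * (exp (- a * t) * exp (- (real n / 4) * (1 - f\<^sup>2)))"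
    by (rule power2_le_imp_le) simp
  then show ?thesis
    by (simp add: f_def a_def integral_one_minus_cos_symmetrized[OF F])
qed

theorem corollary2:
  "\<exists>c::real. c > 0 \<and>
     (\<forall>(n::nat) (F::real measure) (U::real measure) (V::real measure)
        (p::real) (\<sigma>::real) (b::real) (\<delta>::real).
        n \<ge> 1 \<longrightarrow>
        real_distribution F \<longrightarrow> real_distribution U \<longrightarrow> real_distribution V \<longrightarrow>
        0 < p \<longrightarrow> p < 1 \<longrightarrow> is_mixture p U V F \<longrightarrow>
        \<sigma> > 0 \<longrightarrow>
        integrable U (\<lambda>x. x\<^sup>2) \<longrightarrow> \<sigma>\<^sup>2 = (\<integral>x. x\<^sup>2 \<partial>U) \<longrightarrow>
        (\<integral>x. x \<partial>U) = 0 \<longrightarrow>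
        b \<ge> kappa U \<sigma> n / \<sigma>\<^sup>2 \<longrightarrow>
        \<delta> > 0 \<longrightarrow>
        concentration (convolution_power F n) b
          \<le> c * b * (\<delta> + \<sigma>) /
             (\<delta> * \<sigma> * real n *
               sqrt ((1 - p) * truncated_moment (symmetrized F) (\<delta> * sqrt (real n)))))"
proof (intro exI conjI allI impI)
  show "(0 :: real) < 1280" by simp
next
  fix n :: nat and F U V :: "real measure" and p \<sigma> b \<delta> :: real
  assume n: "1 \<le> n" and F: "real_distribution F" and U: "real_distribution U"
    and V: "real_distribution V" and p: "0 < p" "p < 1" and mix: "is_mixture p U V F"
    and s: "0 < \<sigma>" and int: "integrable U (\<lambda>x. x\<^sup>2)" and var: "\<sigma>\<^sup>2 = (\<integral>x. x\<^sup>2 \<partial>U)"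
    and mean: "(\<integral>x. x \<partial>U) = 0" and b: "kappa U \<sigma> n / \<sigma>\<^sup>2 \<le> b" and \<delta>: "0 < \<delta>"
  define r where "r = \<delta> * sqrt (real n)"
  define a where "a = \<sigma> * sqrt (real n * (1 - p)) / 2"
  define D where "D = truncated_moment (symmetrized F) r"
  \<comment> \<open>The factor \<open>4\<close> is the one in the smallness assumption of \<open>norm_char_le_quadratic\<close>.\<close>
  define T where "T = 1 / (4 * b)"
  define G where "G = convolution_power F n"
  let ?e = "\<lambda>t. exp (- a * t) * exp (- (real n / 4) * (\<integral>x. 1 - cos (t * x) \<partial>(symmetrized F)))"
  have r: "0 < r" and a: "0 < a" and n0: "0 < real n"
    using \<delta> n s p by (simp_all add: r_def a_def)
  have D: "0 < D"
    unfolding D_def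
  proof (rule truncated_moment_symmetrized_pos[OF F r])
    show "measure F {c} \<noteq> 1" for c
      using s by (intro mixture_not_point_mass[OF F U V p mix mean]) (simp flip: var)
  qed
  have "\<sigma> \<le> \<sigma> * sqrt (real n)"
    using s n by simp
  from square_min_integral_ge[OF U int var s this] have "3 / 8 * \<sigma> ^ 3 \<le> kappa U \<sigma> n"
    by (simp add: kappa_def)
  moreover have "0 < \<sigma> ^ 3" using s by simp
  ultimately have "0 < kappa U \<sigma> n" by linarith
  then have "0 < kappa U \<sigma> n / \<sigma>\<^sup>2" using s by simp
  with b have b0: "0 < b" by linarith
  have T: "0 < T" using b0 by (simp add: T_def)
  have G: "real_distribution G"
    unfolding G_def by (rule real_distribution_convolution_power[OF F])
  have bound: "measure G {y..y + b} \<le> 20 * b * (2 * (8 / sqrt (real n / 4 * D) * (1 / r + 1 / a)))" for y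
  proof -
    have "b * T \<le> 2 * pi"
      using b0 pi_gt3 by (simp add: T_def)
    from Esseen_concentration_inequality[OF G T this]
    have "ennreal (measure G {y..y + b})
        \<le> ennreal (5 / T) * (\<integral>\<^sup>+t. ennreal (cmod (char G t)) * indicator {0..T} t \<partial>lborel)" .
    also have "\<dots> \<le> ennreal (5 / T) * (\<integral>\<^sup>+t. 2 * (ennreal (?e t) * indicator {0..} t) \<partial>lborel)"
    proof (intro mult_left_mono nn_integral_mono)
      fix t
      show "ennreal (cmod (char G t)) * indicator {0..T} t \<le> 2 * (ennreal (?e t) * indicator {0..} t)"
      proof (cases "0 \<le> t \<and> t \<le> T")
        case True
        have "kappa U \<sigma> n \<le> b * \<sigma>\<^sup>2"
          using b s by (simp add: field_simps)
        then have "4 * t * kappa U \<sigma> n \<le> 4 * T * (b * \<sigma>\<^sup>2)"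
          using True \<open>0 < kappa U \<sigma> n\<close> by (intro mult_mono) auto
        then have "4 * t * kappa U \<sigma> n \<le> \<sigma>\<^sup>2"
          using b0 by (simp add: T_def)
        from power_char_le[OF F U V p mix n s int var mean _ this] True
        have "cmod (char G t) \<le> 2 * ?e t"
          by (simp add: G_def char_convolution_power[OF F] norm_power a_def)
        then have "ennreal (cmod (char G t)) \<le> ennreal (2 * ?e t)"
          by (rule ennreal_leI)
        also have "ennreal (2 * ?e t) = 2 * ennreal (?e t)"
          by (subst ennreal_mult) auto
        finally show ?thesis
          using True by simp
      qed auto
    qed simp
    also have "(\<integral>\<^sup>+t. 2 * (ennreal (?e t) * indicator {0..} t) \<partial>lborel)
        = 2 * (\<integral>\<^sup>+t. ennreal (?e t) * indicator {0..} t \<partial>lborel)"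
    proof (rule nn_integral_cmult)
      have "(\<lambda>t. char F t) \<in> borel_measurable borel"
        by (rule real_distribution.char_measurable[OF F])
      then show "(\<lambda>t. ennreal (?e t) * indicator {0..} t) \<in> borel_measurable lborel"
        unfolding integral_one_minus_cos_symmetrized[OF F] by measurable
    qed
    also have "ennreal (5 / T) * (2 * (\<integral>\<^sup>+t. ennreal (?e t) * indicator {0..} t \<partial>lborel))
        \<le> ennreal (5 / T) * (2 * ennreal (8 / sqrt (real n / 4 * D) * (1 / r + 1 / a)))"
      using D n0 a r unfolding D_def
      by (intro mult_left_mono nn_integral_exp_symmetric_le real_distribution_symmetrized F) auto
    also have "\<dots> = ennreal (20 * b * (2 * (8 / sqrt (real n / 4 * D) * (1 / r + 1 / a))))"
    proof -
      define C where "C = 8 / sqrt (real n / 4 * D) * (1 / r + 1 / a)"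
      have "0 \<le> C" using D n0 a r by (simp add: C_def)
      then have "ennreal (5 / T) * (2 * ennreal C) = ennreal (5 / T * (2 * C))"
        using ennreal_mult[of "5 / T" "2 * C"] ennreal_mult[of 2 C] T by simp
      moreover have "5 / T = 20 * b" by (simp add: T_def)
      ultimately show ?thesis by (simp only: C_def)
    qed
    finally show ?thesis
      using D n0 a r b0 by (subst (asm) ennreal_le_iff) auto
  qed
  have const_le: "20 * b * (2 * (8 / sqrt (real n / 4 * D) * (1 / r + 1 / a)))
      \<le> 1280 * b * (\<delta> + \<sigma>) / (\<delta> * \<sigma> * real n * sqrt ((1 - p) * D))"
  proof -
    \<comment> \<open>As \<open>v \<le> 1\<close>, the factor \<open>1 / v\<close> contained in \<open>1 / a\<close> may also be put on \<open>1 / r\<close>.\<close>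
    define u v w where "u = sqrt (real n)" and "v = sqrt (1 - p)" and "w = sqrt D"
    have pos: "0 < u" "0 < v" "v \<le> 1" "0 < w" and un: "real n = u * u"
      using n0 p D by (simp_all add: u_def v_def w_def)
    have eqs: "sqrt (real n / 4 * D) = u * w / 2" "a = \<sigma> * (u * v) / 2" "r = \<delta> * u"
      by (simp_all add: u_def v_def w_def a_def r_def real_sqrt_divide real_sqrt_mult)
    have "20 * b * (2 * (8 / sqrt (real n / 4 * D) * (1 / r + 1 / a)))
        = 640 * b / (u * w) * (1 / (\<delta> * u) + 2 / (\<sigma> * (u * v)))"
      unfolding eqs by simp
    also have "\<dots> \<le> 640 * b / (u * w) * (2 / (\<delta> * (u * v)) + 2 / (\<sigma> * (u * v)))"
    proof (intro mult_left_mono add_right_mono frac_le mult_left_mono)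
      show "u * v \<le> u" using pos by (simp add: mult_left_le)
    qed (use b0 pos \<delta> s in auto)
    also have "\<dots> = 1280 * b * (\<delta> + \<sigma>) / (\<delta> * \<sigma> * real n * (v * w))"
      using pos \<delta> s by (simp add: un field_simps)
    also have "v * w = sqrt ((1 - p) * D)"
      by (simp add: v_def w_def real_sqrt_mult)
    finally show ?thesis .
  qed
  have "measure G {y..y + b} \<le> 1280 * b * (\<delta> + \<sigma>) / (\<delta> * \<sigma> * real n * sqrt ((1 - p) * D))" for y
    using bound[of y] const_le by linarith
  then show "concentration (convolution_power F n) b \<le> 1280 * b * (\<delta> + \<sigma>) /
      (\<delta> * \<sigma> * real n * sqrt ((1 - p) * truncated_moment (symmetrized F) (\<delta> * sqrt (real n))))"
    unfolding concentration_def G_def[symmetric] D_def r_def by (intro cSUP_least) auto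
qed

end
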